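(* Let $G$ be a finite graph without multiple edges, with loops allowed, and with at least one vertex. Then the full multivariate interlace polynomial $C_G(u,v;\mathbf{x},\mathbf{y})$ is irreducible in the polynomial ring $\mathbb{C}[u,v,x_a,y_a:a\in V(G)]$ if and only if $G$ is connected.
   Context: For a finite graph $G$ without multiple edges (loops allowed), the adjacency matrix $\mathcal{A}(G)=(a_{ij})$ over $\mathbb{F}_2$ is the symmetric matrix whose diagonal entry $a_{ii}$ is $1$ if and only if vertex $i$ is looped, and whose off-diagonal entry $a_{ij}$ is $1$ if and only if $i$ and $j$ are joined by an edge. For $S\subseteq V(G)$, $G[S]$ is the induced subgraph on $S$ (loops at vertices of $S$ are kept). For $B\subseteq V(G)$, $G\nabla B$ is the graph obtained from $G$ by toggling the loop status of every vertex in $B$ (a looped vertex becomes unlooped and vice versa). For disjoint $A,B\subseteq V(G)$, let $$r(A,B)=\operatorname{rank}_{\mathbb{F}_2}\mathcal{A}\bigl((G\nabla B)[A\cup B]\bigr),\qquad n(A,B)=|A\cup B|-r(A,B)$$ (the empty matrix has rank $0$). Take independent indeterminates $u,v$ and $x_a,y_a$ for $a\in V(G)$, and write $\mathbf{x}=\{x_a:a\in V(G)\}$, $\mathbf{y}=\{y_a:a\in V(G)\}$, $x_A=\prod_{a\in A}x_a$, $y_B=\prod_{b\in B}y_b$. The full multivariate interlace polynomial (Courcelle) of $G$ is $$C_G(u,v;\mathbf{x},\mathbf{y})=\sum_{\substack{A,B\subseteq V(G)\\ A\cap B=\varnothing}}x_A\,y_B\,u^{r(A,B)}v^{n(A,B)}.$$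 *)

theory Defs
  imports
    "HOL-Analysis.Cartesian_Space"
    "HOL-Computational_Algebra.Factorial_Ring"
    "HOL-Library.Poly_Mapping"
    "HOL-Library.Z2"
begin

section \<open>Looped graphs\<close>

text \<open>
  An edge is the set of its end points, so a loop at \<open>a\<close> is the singleton \<open>{a} = {a, a}\<close>,
  and there are no multiple edges.
\<close>

record 'a lgraph =
  verts :: "'a set"
  edges :: "'a set set"

definition lgraph :: "'a lgraph \<Rightarrow> bool" where
  "lgraph G \<longleftrightarrow> finite (verts G) \<and> (\<forall>e\<in>edges G. \<exists>a\<in>verts G. \<exists>b\<in>verts G. e = {a, b})"

definition induced :: "'a lgraph \<Rightarrow> 'a set \<Rightarrow> 'a lgraph" where
  "induced G S = \<lparr>verts = S, edges = {e \<in> edges G. e \<subseteq> S}\<rparr>"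

definition toggle_loops :: "'a lgraph \<Rightarrow> 'a set \<Rightarrow> 'a lgraph" where
  "toggle_loops G B =
     (let L = (\<lambda>b. {b}) ` B
      in \<lparr>verts = verts G, edges = (edges G - L) \<union> (L - edges G)\<rparr>)"

definition connected_graph :: "'a lgraph \<Rightarrow> bool" where
  "connected_graph G \<longleftrightarrow>
     (\<forall>a\<in>verts G. \<forall>b\<in>verts G. (a, b) \<in> {(c, d). {c, d} \<in> edges G}\<^sup>*)"

text \<open>
  A matrix with rows and columns indexed by \<open>verts H\<close> is represented as a matrix indexed by the
  whole finite type \<open>'a\<close>, with zeros in the rows and columns outside \<open>verts H\<close>. This does not
  change its rank; for \<open>verts H = {}\<close> the rank is 0.
\<close>

definition adjacency_matrix :: "'a::finite lgraph \<Rightarrow> bit ^ 'a ^ 'a" where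
  "adjacency_matrix H =
     (\<chi> i j. if i \<in> verts H \<and> j \<in> verts H \<and> {i, j} \<in> edges H then 1 else 0)"

definition rk :: "'a::finite lgraph \<Rightarrow> 'a set \<Rightarrow> 'a set \<Rightarrow> nat" where
  "rk G A B = rank (adjacency_matrix (induced (toggle_loops G B) (A \<union> B)))"

definition nullity :: "'a::finite lgraph \<Rightarrow> 'a set \<Rightarrow> 'a set \<Rightarrow> nat" where
  "nullity G A B = card (A \<union> B) - rk G A B"

section \<open>The full multivariate interlace polynomial\<close>

datatype 'a indet = U_var | V_var | X_var 'a | Y_var 'a

text \<open>
  Polynomials are finitely supported maps from monomials to coefficients, and monomials are
  finitely supported maps from indeterminates to exponents; multiplication is convolution.
  For a finite type \<open>'a\<close> this is the ring of polynomials over the complex numbers in the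
  indeterminates \<open>u\<close>, \<open>v\<close>, \<open>x\<^sub>a\<close>, \<open>y\<^sub>a\<close>, where \<open>a\<close> ranges over all elements of \<open>'a\<close>.
\<close>

type_synonym 'a interlace_ring = "('a indet \<Rightarrow>\<^sub>0 nat) \<Rightarrow>\<^sub>0 complex"

definition var :: "'a indet \<Rightarrow> 'a interlace_ring" where
  "var z = Poly_Mapping.single (Poly_Mapping.single z 1) 1"

definition interlace_poly :: "'a::finite lgraph \<Rightarrow> 'a interlace_ring" where
  "interlace_poly G =
     (\<Sum>(A, B) \<in> {(A, B). A \<subseteq> verts G \<and> B \<subseteq> verts G \<and> A \<inter> B = {}}.
        (\<Prod>a\<in>A. var (X_var a)) * (\<Prod>b\<in>B. var (Y_var b)) * var U_var ^ rk G A B * var V_var ^ nullity G A B)"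

end

theory Submission
  imports Defs
begin

text \<open>
  Write \<open>C\<close> for the polynomial. If the vertices split into nonempty sets \<open>S\<close> and \<open>T\<close> without an
  edge between them, every adjacency matrix in the sum is block diagonal, so ranks and nullities
  add and \<open>C = C\<^sub>S C\<^sub>T\<close> (\<open>interlace_poly_disjoint_union\<close>). The factors are not units, because each
  can be specialized to the nonunit \<open>1 + v\<close> by the substitutions below.

  For the converse, suppose that \<open>G\<close> is connected and \<open>C = P Q\<close>. Every monomial of \<open>C\<close> has
  degree at most 1 in \<open>x\<^sub>a, y\<^sub>a\<close> together. This degree is additive on products
  (\<open>factor_degree_zero\<close>), hence each vertex occurs in at most one of \<open>P\<close> and \<open>Q\<close>.
  The relation between the two factors is detected by substitutions. For a set \<open>W\<close> of vertices,
  put \<open>x\<^sub>a = 1\<close> for the unlooped and \<open>y\<^sub>a = 1\<close> for the looped \<open>a \<in> W\<close>, put all other \<open>x\<^sub>a, y\<^sub>a\<close> equal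
  to 0, and keep \<open>u, v\<close>. Looped vertices are thereby always toggled, so that \<open>C\<close> becomes the sum of
  \<open>u\<^sup>r v\<^sup>n\<close> over the induced subgraphs on the subsets of \<open>W\<close>, with all loops removed. In particular
  \<open>W = {}\<close> gives \<open>1\<close>, a single vertex gives \<open>1 + v\<close>, and the two ends of an edge give
  \<open>1 + 2v + u\<^sup>2\<close>.

  Let \<open>p\<close> and \<open>q\<close> be the images of \<open>P\<close> and \<open>Q\<close>, as functions of \<open>W\<close>. If an edge joined a vertex \<open>a\<close>
  that does not occur in \<open>Q\<close> to a vertex \<open>b\<close> that does not occur in \<open>P\<close>, then
  \<open>p{a,b} = p{a}\<close>, \<open>p{b} = p{}\<close>, and likewise for \<open>q\<close>, so
  \<open>pq{a,b} \<cdot> pq{} = pq{a} \<cdot> pq{b}\<close>, that is \<open>1 + 2v + u\<^sup>2 = (1 + v)\<^sup>2\<close>, which is absurd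
  (\<open>factors_joined_by_no_edge\<close>). Hence occurrence in \<open>P\<close> spreads along edges, and by connectedness
  one of the factors contains no vertex at all. That factor is unchanged by the substitution for
  \<open>W = {}\<close>, which turns \<open>C\<close> into \<open>1\<close>, so it is a unit (\<open>factor_without_vertices_unit\<close>).
\<close>

section \<open>Substitution\<close>

definition subst_poly :: "('z::finite \<Rightarrow> ('w \<Rightarrow>\<^sub>0 nat) \<Rightarrow>\<^sub>0 'c) \<Rightarrow> (('z \<Rightarrow>\<^sub>0 nat) \<Rightarrow>\<^sub>0 'c)
    \<Rightarrow> ('w \<Rightarrow>\<^sub>0 nat) \<Rightarrow>\<^sub>0 'c::comm_semiring_1" where
  "subst_poly e P = (\<Sum>m\<in>Poly_Mapping.keys P.
     Poly_Mapping.single 0 (Poly_Mapping.lookup P m) * (\<Prod>z\<in>UNIV. e z ^ Poly_Mapping.lookup m z))"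

lemma subst_poly_superset:
  assumes "finite K" "Poly_Mapping.keys P \<subseteq> K"
  shows "subst_poly e P = (\<Sum>m\<in>K.
     Poly_Mapping.single 0 (Poly_Mapping.lookup P m) * (\<Prod>z\<in>UNIV. e z ^ Poly_Mapping.lookup m z))"
  unfolding subst_poly_def
  by (rule sum.mono_neutral_left) (use assms in \<open>auto simp: in_keys_iff\<close>)

lemma subst_poly_single:
  "subst_poly e (Poly_Mapping.single m c)
     = Poly_Mapping.single 0 c * (\<Prod>z\<in>UNIV. e z ^ Poly_Mapping.lookup m z)"
  by (subst subst_poly_superset[of "{m}"]) auto

lemma subst_poly_add: "subst_poly e (P + Q) = subst_poly e P + subst_poly e Q"
proof -
  let ?K = "Poly_Mapping.keys P \<union> Poly_Mapping.keys Q"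
  have K: "finite ?K" "Poly_Mapping.keys (P + Q) \<subseteq> ?K"
    "Poly_Mapping.keys P \<subseteq> ?K" "Poly_Mapping.keys Q \<subseteq> ?K"
    using keys_add[of P Q] by auto
  show ?thesis
    by (simp add: subst_poly_superset[OF K(1,2)] subst_poly_superset[OF K(1,3)]
        subst_poly_superset[OF K(1,4)] lookup_add single_add algebra_simps sum.distrib)
qed

lemma subst_poly_sum: "subst_poly e (\<Sum>i\<in>I. P i) = (\<Sum>i\<in>I. subst_poly e (P i))"
proof (cases "finite I")
  case True
  then show ?thesis
    by induction (auto simp: subst_poly_add subst_poly_def[of e 0])
qed (simp add: subst_poly_def)

lemma sum_of_monomials:
  "(\<Sum>m\<in>Poly_Mapping.keys P. Poly_Mapping.single m (Poly_Mapping.lookup P m)) = P"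
  by (rule poly_mapping_eqI) (auto simp: lookup_sum lookup_single when_def in_keys_iff)

lemma mult_as_sum_of_monomials:
  "P * Q = (\<Sum>m\<in>Poly_Mapping.keys P. \<Sum>n\<in>Poly_Mapping.keys Q.
     Poly_Mapping.single (m + n) (Poly_Mapping.lookup P m * Poly_Mapping.lookup Q n))"
  by (subst (1) sum_of_monomials[of P, symmetric], subst (1) sum_of_monomials[of Q, symmetric])
    (simp add: sum_product mult_single)

lemma subst_poly_mult: "subst_poly e (P * Q) = subst_poly e P * subst_poly e Q"
proof -
  let ?p = "\<lambda>m. \<Prod>z\<in>UNIV. e z ^ Poly_Mapping.lookup m z"
  have *: "Poly_Mapping.single 0 (a * b) = Poly_Mapping.single 0 a * Poly_Mapping.single 0 b"
    for a b :: "'b::comm_semiring_1" by (simp add: mult_single)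
  have mon: "subst_poly e (Poly_Mapping.single (m + n) (a * b))
    = (Poly_Mapping.single 0 a * ?p m) * (Poly_Mapping.single 0 b * ?p n)" for m n a b
    unfolding subst_poly_single * by (simp add: lookup_add power_add prod.distrib mult_ac)
  show ?thesis
    unfolding mult_as_sum_of_monomials[of P Q] subst_poly_sum mon
    unfolding subst_poly_def[of e P] subst_poly_def[of e Q] sum_product ..
qed

lemma subst_poly_one: "subst_poly e 1 = 1"
  using subst_poly_single[of e 0 1] by simp

lemma subst_poly_prod: "subst_poly e (\<Prod>i\<in>I. P i) = (\<Prod>i\<in>I. subst_poly e (P i))"
  by (induction I rule: infinite_finite_induct) (auto simp: subst_poly_one subst_poly_mult)

lemma subst_poly_power: "subst_poly e (P ^ n) = subst_poly e P ^ n"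
  by (induction n) (auto simp: subst_poly_one subst_poly_mult)

text \<open>
  Only the indeterminates that occur in \<open>P\<close> matter. Two substitutions that differ on the
  interlace polynomial can therefore agree on one of its factors.
\<close>

lemma subst_poly_cong:
  assumes "\<And>m z. m \<in> Poly_Mapping.keys P \<Longrightarrow> Poly_Mapping.lookup m z \<noteq> 0 \<Longrightarrow> e z = e' z"
  shows "subst_poly e P = subst_poly e' P"
proof -
  have "e z ^ Poly_Mapping.lookup m z = e' z ^ Poly_Mapping.lookup m z"
    if "m \<in> Poly_Mapping.keys P" for m z
    using assms[OF that, of z] by (cases "Poly_Mapping.lookup m z = 0") simp_all
  then show ?thesis unfolding subst_poly_def by simp
qed

lemma finite_indet: "finite (UNIV :: 'a::finite indet set)"
proof (rule finite_subset)
  show "UNIV \<subseteq> {U_var, V_var} \<union> range X_var \<union> range (Y_var :: 'a \<Rightarrow> _)"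
  proof
    fix z :: "'a indet"
    show "z \<in> {U_var, V_var} \<union> range X_var \<union> range Y_var" by (cases z) simp_all
  qed
qed simp

instance indet :: (finite) finite
  by standard (rule finite_indet)

lemma subst_poly_var:
  fixes e :: "'a::finite indet \<Rightarrow> 'a interlace_ring"
  shows "subst_poly e (var z) = e z"
proof -
  have "(\<Prod>y\<in>UNIV. e y ^ Poly_Mapping.lookup (Poly_Mapping.single z 1) y)
    = (\<Prod>y\<in>UNIV. if y = z then e y else 1)"
    by (intro prod.cong) (auto simp: lookup_single when_def)
  then show ?thesis by (simp add: var_def subst_poly_single)
qed

section \<open>Degrees in products\<close>

lemma finite_set_has_maximizer:
  fixes d :: "'b \<Rightarrow> nat"
  assumes "finite R" "R \<noteq> {}"
  shows "\<exists>r\<in>R. \<forall>r'\<in>R. d r' \<le> d r"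
proof -
  have "Max (d ` R) \<in> d ` R" using assms by simp
  then obtain r where "r \<in> R" "d r = Max (d ` R)" by force
  then show ?thesis using assms by (metis Max_ge finite_imageI imageI)
qed

text \<open>
  Take the lexicographically largest monomials: maximize the exponents of the indeterminates one
  after the other, restricting \<open>S\<close> and \<open>T\<close> each time to the maximizers. If \<open>s' + t' = s + t\<close> and both \<open>s\<close> and \<open>t\<close> have the largest
  exponent of an indeterminate, then \<open>s'\<close> and \<open>t'\<close> have it too.
\<close>

lemma ex_unique_sum:
  fixes S T :: "('z::finite \<Rightarrow>\<^sub>0 nat) set"
  assumes "finite S" "S \<noteq> {}" "finite T" "T \<noteq> {}"
  shows "\<exists>s\<in>S. \<exists>t\<in>T. \<forall>s'\<in>S. \<forall>t'\<in>T. s' + t' = s + t \<longrightarrow> s' = s \<and> t' = t"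
proof -
  \<comment> \<open>\<open>Z\<close> is the set of indeterminates whose exponents are still to be maximized.\<close>
  have "\<exists>s\<in>S. \<exists>t\<in>T. \<forall>s'\<in>S. \<forall>t'\<in>T. s' + t' = s + t \<longrightarrow> s' = s \<and> t' = t"
    if "finite Z" "finite S" "S \<noteq> {}" "finite T" "T \<noteq> {}"
      "\<And>s s' z. s \<in> S \<Longrightarrow> s' \<in> S \<Longrightarrow> z \<notin> Z \<Longrightarrow> Poly_Mapping.lookup s z = Poly_Mapping.lookup s' z"
      "\<And>t t' z. t \<in> T \<Longrightarrow> t' \<in> T \<Longrightarrow> z \<notin> Z \<Longrightarrow> Poly_Mapping.lookup t z = Poly_Mapping.lookup t' z"
    for Z :: "'z set" and S T :: "('z \<Rightarrow>\<^sub>0 nat) set"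
    using that
  proof (induction Z arbitrary: S T rule: finite_induct)
    case empty
    then obtain s t where "s \<in> S" "t \<in> T" by auto
    moreover have "s' = s" if "s' \<in> S" for s'
      by (rule poly_mapping_eqI) (use empty.prems(5) \<open>s \<in> S\<close> that in blast)
    moreover have "t' = t" if "t' \<in> T" for t'
      by (rule poly_mapping_eqI) (use empty.prems(6) \<open>t \<in> T\<close> that in blast)
    ultimately show ?case by blast
  next
    case (insert z Z)
    let ?d = "\<lambda>m. Poly_Mapping.lookup m z"
    define S' where "S' = {s \<in> S. \<forall>s'\<in>S. ?d s' \<le> ?d s}"
    define T' where "T' = {t \<in> T. \<forall>t'\<in>T. ?d t' \<le> ?d t}"
    have "\<exists>s\<in>S'. \<exists>t\<in>T'. \<forall>s'\<in>S'. \<forall>t'\<in>T'. s' + t' = s + t \<longrightarrow> s' = s \<and> t' = t"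
    proof (rule insert.IH)
      show "finite S'" "S' \<noteq> {}" using insert.prems(1,2) finite_set_has_maximizer[of S ?d] unfolding S'_def by auto
      show "finite T'" "T' \<noteq> {}" using insert.prems(3,4) finite_set_has_maximizer[of T ?d] unfolding T'_def by auto
      show "Poly_Mapping.lookup s y = Poly_Mapping.lookup s' y"
        if "s \<in> S'" "s' \<in> S'" "y \<notin> Z" for s s' y
        using that insert.prems(5)[of s s' y] unfolding S'_def by (cases "y = z") (auto intro: antisym)
      show "Poly_Mapping.lookup t y = Poly_Mapping.lookup t' y"
        if "t \<in> T'" "t' \<in> T'" "y \<notin> Z" for t t' y
        using that insert.prems(6)[of t t' y] unfolding T'_def by (cases "y = z") (auto intro: antisym)
    qed
    then obtain s t where st: "s \<in> S'" "t \<in> T'"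
      and uniq: "\<And>s' t'. s' \<in> S' \<Longrightarrow> t' \<in> T' \<Longrightarrow> s' + t' = s + t \<Longrightarrow> s' = s \<and> t' = t" by blast
    have "s' = s \<and> t' = t" if "s' \<in> S" "t' \<in> T" "s' + t' = s + t" for s' t'
    proof -
      have "?d s' + ?d t' = ?d s + ?d t"
        using arg_cong[OF that(3), of ?d] by (simp add: lookup_add)
      moreover have "?d s' \<le> ?d s" "?d t' \<le> ?d t" using st that by (auto simp: S'_def T'_def)
      ultimately have "?d s' = ?d s" "?d t' = ?d t" by auto
      then have "s' \<in> S'" "t' \<in> T'" using st that by (auto simp: S'_def T'_def)
      then show ?thesis using uniq that by blast
    qed
    then show ?case using st unfolding S'_def T'_def by blast
  qed
  from this[of UNIV S T] assms show ?thesis by auto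
qed

text \<open>
  Additive degrees add up in products. Among the monomials of \<open>P\<close> and of \<open>Q\<close> of largest degree
  there are, by \<open>ex_unique_sum\<close>, two whose product arises in only one way; the terms of smaller
  degree cannot contribute to it, so nothing cancels it.
\<close>

lemma mult_attains_top_degree:
  fixes P Q :: "('z::finite \<Rightarrow>\<^sub>0 nat) \<Rightarrow>\<^sub>0 'c::idom" and d :: "('z \<Rightarrow>\<^sub>0 nat) \<Rightarrow> nat"
  assumes d: "\<And>m n. d (m + n) = d m + d n" and "P \<noteq> 0" "Q \<noteq> 0"
  shows "\<exists>k\<in>Poly_Mapping.keys (P * Q).
    \<forall>m\<in>Poly_Mapping.keys P. \<forall>n\<in>Poly_Mapping.keys Q. d m + d n \<le> d k"
proof -
  define S where "S = {s \<in> Poly_Mapping.keys P. \<forall>m\<in>Poly_Mapping.keys P. d m \<le> d s}"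
  define T where "T = {t \<in> Poly_Mapping.keys Q. \<forall>n\<in>Poly_Mapping.keys Q. d n \<le> d t}"
  have "Poly_Mapping.keys P \<noteq> {}" "Poly_Mapping.keys Q \<noteq> {}"
    using assms(2,3) by auto
  then have "finite S" "S \<noteq> {}" "finite T" "T \<noteq> {}"
    using finite_set_has_maximizer[of "Poly_Mapping.keys P" d]
      finite_set_has_maximizer[of "Poly_Mapping.keys Q" d]
    unfolding S_def T_def by auto
  then obtain s t where st: "s \<in> S" "t \<in> T"
    and uniq: "\<And>s' t'. s' \<in> S \<Longrightarrow> t' \<in> T \<Longrightarrow> s' + t' = s + t \<Longrightarrow> s' = s \<and> t' = t"
    using ex_unique_sum[of S T] by blast
  have sP: "s \<in> Poly_Mapping.keys P" and tQ: "t \<in> Poly_Mapping.keys Q"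
    using st by (auto simp: S_def T_def)
  have eq: "m + n = s + t \<longleftrightarrow> m = s \<and> n = t"
    if "m \<in> Poly_Mapping.keys P" "n \<in> Poly_Mapping.keys Q" for m n
  proof
    assume mn: "m + n = s + t"
    then have "d m + d n = d s + d t" by (metis d)
    moreover have "d m \<le> d s" "d n \<le> d t" using st that by (auto simp: S_def T_def)
    ultimately have "d m = d s" "d n = d t" by auto
    then have "m \<in> S" "n \<in> T" using st that by (auto simp: S_def T_def)
    then show "m = s \<and> n = t" using uniq mn by blast
  qed auto
  have "Poly_Mapping.lookup (P * Q) (s + t)
    = (\<Sum>m\<in>Poly_Mapping.keys P. \<Sum>n\<in>Poly_Mapping.keys Q.
       if m = s \<and> n = t then Poly_Mapping.lookup P m * Poly_Mapping.lookup Q n else 0)"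
    unfolding mult_as_sum_of_monomials[of P Q] lookup_sum lookup_single when_def
    by (intro sum.cong refl) (auto simp: eq)
  also have "\<dots> = (\<Sum>m\<in>Poly_Mapping.keys P. if m = s then Poly_Mapping.lookup P s * Poly_Mapping.lookup Q t else 0)"
    using tQ by (intro sum.cong refl) auto
  also have "\<dots> = Poly_Mapping.lookup P s * Poly_Mapping.lookup Q t"
    using sP by simp
  finally have "s + t \<in> Poly_Mapping.keys (P * Q)"
    using sP tQ by (simp add: in_keys_iff)
  then show ?thesis
    using st by (intro bexI[of _ "s + t"]) (auto simp: S_def T_def d add_mono)
qed

lemma unit_degree_zero:
  fixes P :: "('z::finite \<Rightarrow>\<^sub>0 nat) \<Rightarrow>\<^sub>0 'c::idom" and d :: "('z \<Rightarrow>\<^sub>0 nat) \<Rightarrow> nat"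
  assumes d: "\<And>m n. d (m + n) = d m + d n" and "P dvd 1" and m: "m \<in> Poly_Mapping.keys P"
  shows "d m = 0"
proof -
  obtain Q where Q: "1 = P * Q" using assms(2) by blast
  then have "P \<noteq> 0" "Q \<noteq> 0" by auto
  then obtain n where n: "n \<in> Poly_Mapping.keys Q" by (metis equals0I keys_eq_empty)
  have "d 0 = 0" using d[of 0 0] by simp
  moreover obtain k where "k \<in> Poly_Mapping.keys (1 :: ('z \<Rightarrow>\<^sub>0 nat) \<Rightarrow>\<^sub>0 'c)" "d m + d n \<le> d k"
    using mult_attains_top_degree[OF d \<open>P \<noteq> 0\<close> \<open>Q \<noteq> 0\<close>] Q m n by auto
  ultimately show ?thesis by simp
qed

lemma factor_degree_zero:
  fixes P Q :: "('z::finite \<Rightarrow>\<^sub>0 nat) \<Rightarrow>\<^sub>0 'c::idom" and d :: "('z \<Rightarrow>\<^sub>0 nat) \<Rightarrow> nat"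
  assumes d: "\<And>m n. d (m + n) = d m + d n"
    and le: "\<And>k. k \<in> Poly_Mapping.keys (P * Q) \<Longrightarrow> d k \<le> 1"
  shows "(\<forall>m\<in>Poly_Mapping.keys P. d m = 0) \<or> (\<forall>n\<in>Poly_Mapping.keys Q. d n = 0)"
proof (rule ccontr)
  assume "\<not> ?thesis"
  then obtain m n where mn: "m \<in> Poly_Mapping.keys P" "d m \<noteq> 0" "n \<in> Poly_Mapping.keys Q" "d n \<noteq> 0"
    by auto
  then have "P \<noteq> 0" "Q \<noteq> 0" by auto
  then obtain k where "k \<in> Poly_Mapping.keys (P * Q)" "d m + d n \<le> d k"
    using mult_attains_top_degree[OF d] mn by blast
  then show False using le[of k] mn by auto
qed

section \<open>Ranks of adjacency matrices\<close>

text \<open>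
  Each row of \<open>M + N\<close> is a row of \<open>M\<close> or of \<open>N\<close>, and the two row spaces meet only in 0 because
  they live on disjoint sets of coordinates.
\<close>

lemma rank_add_disjoint_support:
  fixes M N :: "'k::field ^ 'a::finite ^ 'a"
  assumes "S \<inter> T = {}"
    and M: "\<And>i j. M $ i $ j \<noteq> 0 \<Longrightarrow> i \<in> S \<and> j \<in> S"
    and N: "\<And>i j. N $ i $ j \<noteq> 0 \<Longrightarrow> i \<in> T \<and> j \<in> T"
  shows "rank (M + N) = rank M + rank N"
proof -
  have row: "row i (M + N) = row i M + row i N" for i by (simp add: row_def vec_eq_iff)
  have rM: "i \<in> S" if "row i M \<noteq> 0" for i using that M by (auto simp: row_def vec_eq_iff)
  have rN: "i \<in> T" if "row i N \<noteq> 0" for i using that N by (auto simp: row_def vec_eq_iff)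
  have cases: "row i M = 0 \<or> row i N = 0" for i using rM rN assms(1) by blast
  have "rows (M + N) \<subseteq> rows M \<union> rows N"
  proof
    fix v assume "v \<in> rows (M + N)"
    then obtain i where "v = row i (M + N)" unfolding rows_def by blast
    then have "v = row i M \<or> v = row i N" using row[of i] cases[of i] by auto
    then show "v \<in> rows M \<union> rows N" unfolding rows_def by blast
  qed
  moreover have "rows M \<union> rows N \<subseteq> insert 0 (rows (M + N))"
  proof -
    have "row i M \<in> insert 0 (rows (M + N))" "row i N \<in> insert 0 (rows (M + N))" for i
    proof -
      have "row i (M + N) \<in> rows (M + N)" unfolding rows_def by blast
      moreover have "row i M \<in> {0, row i (M + N)}" "row i N \<in> {0, row i (M + N)}"
        using cases[of i] row[of i] by auto
      ultimately show "row i M \<in> insert 0 (rows (M + N))" "row i N \<in> insert 0 (rows (M + N))"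
        by (metis insert_iff empty_iff)+
    qed
    then show ?thesis unfolding rows_def by blast
  qed
  ultimately have "vec.span (rows (M + N)) = vec.span (rows M \<union> rows N)"
    by (metis vec.span_insert_0 vec.span_mono subset_antisym)
  then have "rank (M + N) = vec.dim {x + y |x y. x \<in> vec.span (rows M) \<and> y \<in> vec.span (rows N)}"
    unfolding row_rank_def_gen vec.span_Un[symmetric] by (metis vec.dim_span)
  moreover have "vec.dim (vec.span (rows M) \<inter> vec.span (rows N)) = 0"
  proof -
    have sub: "vec.subspace {x :: 'k ^ 'a. \<forall>j. x $ j \<noteq> 0 \<longrightarrow> j \<in> R}" for R :: "'a set"
      by (auto simp: vec.subspace_def) force
    have "vec.span (rows M) \<subseteq> {x. \<forall>j. x $ j \<noteq> 0 \<longrightarrow> j \<in> S}"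
      by (rule vec.span_minimal[OF _ sub]) (auto simp: rows_def row_def M)
    moreover have "vec.span (rows N) \<subseteq> {x. \<forall>j. x $ j \<noteq> 0 \<longrightarrow> j \<in> T}"
      by (rule vec.span_minimal[OF _ sub]) (auto simp: rows_def row_def N)
    ultimately have "x = 0" if "x \<in> vec.span (rows M) \<inter> vec.span (rows N)" for x
      using assms(1) that unfolding vec_eq_iff by fastforce
    then show ?thesis unfolding vec.dim_eq_0 by blast
  qed
  ultimately show ?thesis
    using vec.dim_sums_Int[OF vec.subspace_span vec.subspace_span, of "rows M" "rows N"]
    unfolding row_rank_def_gen vec.dim_span by linarith
qed

lemma rank_le_card_support:
  fixes M :: "'k::field ^ 'a::finite ^ 'a"
  assumes "\<And>i j. M $ i $ j \<noteq> 0 \<Longrightarrow> i \<in> S"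
  shows "rank M \<le> card S"
proof -
  have "row i M \<in> vec.span ((\<lambda>i. row i M) ` S)" for i
  proof (cases "i \<in> S")
    case False
    then have "row i M = 0" using assms by (auto simp: row_def vec_eq_iff)
    then show ?thesis by (simp add: vec.span_zero)
  qed (simp add: vec.span_base)
  then have "rank M \<le> card ((\<lambda>i. row i M) ` S)"
    unfolding row_rank_def_gen by (intro vec.dim_le_card) (auto simp: rows_def)
  also have "\<dots> \<le> card S" by (rule card_image_le) simp
  finally show ?thesis .
qed

lemma adjacency_matrix_induced_toggle:
  "adjacency_matrix (induced (toggle_loops G B) S) $ i $ j =
    (if i \<in> S \<and> j \<in> S \<and> (if i = j then ({i} \<in> edges G) \<noteq> (i \<in> B) else {i, j} \<in> edges G)
     then 1 else 0)"
proof -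
  have "{i, j} \<in> (\<lambda>b. {b}) ` B \<longleftrightarrow> i = j \<and> i \<in> B" by auto
  then show ?thesis
    by (cases "i = j") (simp_all add: adjacency_matrix_def induced_def toggle_loops_def Let_def, blast)
qed

text \<open>
  By this bound the natural subtraction in the nullity is never truncated, so that additivity of
  nullities over disjoint unions follows from additivity of ranks.
\<close>

lemma rk_le_card: "rk G A B \<le> card (A \<union> B)"
  unfolding rk_def by (rule rank_le_card_support) (auto simp: adjacency_matrix_induced_toggle split: if_splits)

lemma rk_disjoint_union:
  assumes "S \<inter> T = {}" "\<And>a b. a \<in> S \<Longrightarrow> b \<in> T \<Longrightarrow> {a, b} \<notin> edges G"
    and "A \<union> B \<subseteq> S" "A' \<union> B' \<subseteq> T"
  shows "rk G (A \<union> A') (B \<union> B') = rk G A B + rk G A' B'"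
proof -
  have "adjacency_matrix (induced (toggle_loops G (B \<union> B')) (A \<union> A' \<union> (B \<union> B')))
    = adjacency_matrix (induced (toggle_loops G B) (A \<union> B))
    + adjacency_matrix (induced (toggle_loops G B') (A' \<union> B'))"
    (is "?L = ?R")
  proof -
    have "?L $ i $ j = ?R $ i $ j" for i j
    proof -
      have *: "i \<in> S \<Longrightarrow> i \<notin> T" "j \<in> S \<Longrightarrow> j \<notin> T"
        "i \<in> S \<Longrightarrow> j \<in> T \<Longrightarrow> {i, j} \<notin> edges G" "j \<in> S \<Longrightarrow> i \<in> T \<Longrightarrow> {i, j} \<notin> edges G"
        using assms(1) assms(2)[of i j] assms(2)[of j i] by (auto simp: insert_commute)
      have **: "k \<in> A \<or> k \<in> B \<Longrightarrow> k \<in> S" "k \<in> A' \<or> k \<in> B' \<Longrightarrow> k \<in> T" for k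
        using assms(3,4) by auto
      show ?thesis
        unfolding vector_add_component adjacency_matrix_induced_toggle Un_iff
        using * **[of i] **[of j] by (cases "i = j") (simp_all, argo+)
    qed
    then show ?thesis unfolding vec_eq_iff by blast
  qed
  then show ?thesis
    unfolding rk_def
    by (simp, intro rank_add_disjoint_support[OF assms(1)])
      (use assms(3,4) in \<open>auto simp: adjacency_matrix_induced_toggle split: if_splits\<close>)
qed

lemma nullity_disjoint_union:
  assumes "S \<inter> T = {}" "\<And>a b. a \<in> S \<Longrightarrow> b \<in> T \<Longrightarrow> {a, b} \<notin> edges G"
    and "A \<union> B \<subseteq> S" "A' \<union> B' \<subseteq> T"
  shows "nullity G (A \<union> A') (B \<union> B') = nullity G A B + nullity G A' B'"
proof -
  have "card (A \<union> A' \<union> (B \<union> B')) = card (A \<union> B) + card (A' \<union> B')"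
  proof -
    have "A \<union> A' \<union> (B \<union> B') = (A \<union> B) \<union> (A' \<union> B')" by blast
    moreover have "(A \<union> B) \<inter> (A' \<union> B') = {}" using assms(1,3,4) by blast
    ultimately show ?thesis by (simp add: card_Un_disjoint)
  qed
  then show ?thesis
    using rk_disjoint_union[OF assms] rk_le_card[of G A B] rk_le_card[of G A' B']
    by (simp add: nullity_def)
qed

section \<open>Disjoint unions\<close>

lemma rk_induced: "A \<union> B \<subseteq> S \<Longrightarrow> rk (induced G S) A B = rk G A B"
proof -
  assume "A \<union> B \<subseteq> S"
  then have "adjacency_matrix (induced (toggle_loops (induced G S) B) (A \<union> B))
    = adjacency_matrix (induced (toggle_loops G B) (A \<union> B))"
    unfolding vec_eq_iff adjacency_matrix_induced_toggle by (auto simp: induced_def)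
  then show ?thesis by (simp add: rk_def)
qed

definition interlace_term :: "'a::finite lgraph \<Rightarrow> 'a set \<Rightarrow> 'a set \<Rightarrow> 'a interlace_ring" where
  "interlace_term G A B = (\<Prod>a\<in>A. var (X_var a)) * (\<Prod>b\<in>B. var (Y_var b))
     * var U_var ^ rk G A B * var V_var ^ nullity G A B"

definition disjoint_pairs :: "'a set \<Rightarrow> ('a set \<times> 'a set) set" where
  "disjoint_pairs S = {(A, B). A \<subseteq> S \<and> B \<subseteq> S \<and> A \<inter> B = {}}"

lemma interlace_poly_eq:
  "interlace_poly G = (\<Sum>(A, B)\<in>disjoint_pairs (verts G). interlace_term G A B)"
  unfolding interlace_poly_def interlace_term_def disjoint_pairs_def ..

lemma interlace_poly_induced:
  "interlace_poly (induced G S) = (\<Sum>(A, B)\<in>disjoint_pairs S. interlace_term G A B)"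
  unfolding interlace_poly_eq
  by (intro sum.cong)
    (auto simp: induced_def[of G S] disjoint_pairs_def interlace_term_def nullity_def
      rk_induced[unfolded induced_def])

text \<open>
  A pair of disjoint subsets of \<open>S \<union> T\<close> is the same as such a pair in \<open>S\<close> together with one in \<open>T\<close>,
  and the corresponding term of the sum is the product of the two terms.
\<close>

lemma interlace_poly_disjoint_union:
  assumes "verts G = S \<union> T" "S \<inter> T = {}" "\<And>a b. a \<in> S \<Longrightarrow> b \<in> T \<Longrightarrow> {a, b} \<notin> edges G"
  shows "interlace_poly G = interlace_poly (induced G S) * interlace_poly (induced G T)"
proof -
  let ?f = "\<lambda>((A, B), (A', B')). (A \<union> A', B \<union> B')"
  have bij: "bij_betw ?f (disjoint_pairs S \<times> disjoint_pairs T) (disjoint_pairs (S \<union> T))"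
    by (rule bij_betw_byWitness[where f' = "\<lambda>(A, B). ((A \<inter> S, B \<inter> S), (A \<inter> T, B \<inter> T))"])
      (use assms(2) in \<open>auto simp: disjoint_pairs_def\<close>)
  have mult: "interlace_term G (A \<union> A') (B \<union> B') = interlace_term G A B * interlace_term G A' B'"
    if "(A, B) \<in> disjoint_pairs S" "(A', B') \<in> disjoint_pairs T" for A B A' B'
  proof -
    have sub: "A \<union> B \<subseteq> S" "A' \<union> B' \<subseteq> T" using that by (auto simp: disjoint_pairs_def)
    then have "A \<inter> A' = {}" "B \<inter> B' = {}" using assms(2) by auto
    then show ?thesis
      unfolding interlace_term_def rk_disjoint_union[OF assms(2,3) sub, simplified]
        nullity_disjoint_union[OF assms(2,3) sub, simplified]
      by (simp add: prod.union_disjoint power_add mult_ac)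
  qed
  show ?thesis
    unfolding interlace_poly_induced sum_product sum.cartesian_product
    unfolding interlace_poly_eq assms(1) sum.reindex_bij_betw[OF bij, symmetric]
    by (intro sum.cong) (auto simp: mult)
qed

section \<open>Probing the polynomial on a set of vertices\<close>

text \<open>
  The choice between \<open>x\<^sub>a\<close> and \<open>y\<^sub>a\<close> is made so that the terms that survive are exactly those of
  the subgraphs induced on subsets of \<open>W\<close> with every loop removed. In this way the original loops
  of the graph have no influence on the result.
\<close>

definition probe :: "'a::finite lgraph \<Rightarrow> 'a set \<Rightarrow> 'a indet \<Rightarrow> 'a interlace_ring" where
  "probe G W z = (case z of U_var \<Rightarrow> var U_var | V_var \<Rightarrow> var V_var
     | X_var a \<Rightarrow> (if a \<in> W \<and> {a} \<notin> edges G then 1 else 0)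
     | Y_var a \<Rightarrow> (if a \<in> W \<and> {a} \<in> edges G then 1 else 0))"

definition looped :: "'a lgraph \<Rightarrow> 'a set" where
  "looped G = {a. {a} \<in> edges G}"

lemma subst_poly_probe_interlace_poly:
  assumes "W \<subseteq> verts G"
  shows "subst_poly (probe G W) (interlace_poly G) = (\<Sum>Z\<in>Pow W.
    var U_var ^ rk G (Z - looped G) (Z \<inter> looped G) * var V_var ^ nullity G (Z - looped G) (Z \<inter> looped G))"
proof -
  let ?L = "looped G"
  have if_prod: "(\<Prod>a\<in>A. if Q a then 1 else 0 :: 'a interlace_ring) = (if \<forall>a\<in>A. Q a then 1 else 0)"
    for A :: "'a set" and Q
  proof -
    have "finite A" by simp
    then show ?thesis by induction auto
  qed
  have "subst_poly (probe G W) (interlace_poly G) = (\<Sum>(A, B)\<in>disjoint_pairs (verts G).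
      if A \<subseteq> W - ?L \<and> B \<subseteq> W \<inter> ?L then var U_var ^ rk G A B * var V_var ^ nullity G A B else 0)"
    unfolding interlace_poly_eq subst_poly_sum interlace_term_def
    by (intro sum.cong)
      (auto simp: subst_poly_mult subst_poly_prod subst_poly_power subst_poly_var probe_def if_prod
        looped_def)
  also have "\<dots> = (\<Sum>(A, B)\<in>Pow (W - ?L) \<times> Pow (W \<inter> ?L).
      var U_var ^ rk G A B * var V_var ^ nullity G A B)"
    by (rule sum.mono_neutral_cong_right) (use assms in \<open>auto simp: disjoint_pairs_def split: if_splits\<close>)
  also have "\<dots> = (\<Sum>Z\<in>Pow W. var U_var ^ rk G (Z - ?L) (Z \<inter> ?L) * var V_var ^ nullity G (Z - ?L) (Z \<inter> ?L))"
    by (rule sum.reindex_bij_witness[where i = "\<lambda>Z. (Z - ?L, Z \<inter> ?L)" and j = "\<lambda>(A, B). A \<union> B"])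
      (auto intro!: arg_cong2[where f = "(*)"] arg_cong2[where f = "(^)"] arg_cong2[where f = "rk G"]
        arg_cong2[where f = "nullity G"])
  finally show ?thesis .
qed

text \<open>
  In the graph that is left when all loops are removed, one vertex has rank 0 and the two ends of
  an edge have rank 2. This defect of additivity across an edge is what forces irreducibility.
\<close>

lemma adjacency_matrix_unlooped:
  "adjacency_matrix (induced (toggle_loops G (Z \<inter> looped G)) Z) $ i $ j =
    (if i \<in> Z \<and> j \<in> Z \<and> i \<noteq> j \<and> {i, j} \<in> edges G then 1 else 0)"
  unfolding adjacency_matrix_induced_toggle by (auto simp: looped_def)

lemma rk_unlooped_vertex: "rk G ({a} - looped G) ({a} \<inter> looped G) = 0"
proof -
  have "adjacency_matrix (induced (toggle_loops G ({a} \<inter> looped G)) {a}) = 0"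
    unfolding vec_eq_iff adjacency_matrix_unlooped by auto
  then have "rows (adjacency_matrix (induced (toggle_loops G ({a} \<inter> looped G)) {a})) \<subseteq> {0}"
    by (auto simp: rows_def row_def vec_eq_iff)
  then show ?thesis by (simp add: rk_def row_rank_def_gen Un_Diff_Int)
qed

lemma rk_empty: "rk G {} {} = 0"
  using rk_le_card[of G "{}" "{}"] by simp

lemma rk_unlooped_edge:
  assumes "a \<noteq> b" "{a, b} \<in> edges G"
  shows "rk G ({a, b} - looped G) ({a, b} \<inter> looped G) = 2"
proof -
  let ?M = "adjacency_matrix (induced (toggle_loops G ({a, b} \<inter> looped G)) {a, b})"
  have "row a ?M = axis b 1" "row b ?M = axis a 1"
    unfolding vec_eq_iff row_def axis_def using assms
    by (auto simp: adjacency_matrix_unlooped insert_commute)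
  then have "{axis b 1, axis a 1} \<subseteq> rows ?M" unfolding rows_def by (smt (verit) CollectI UNIV_I insertE singletonD subsetI)
  moreover have "vec.independent {axis b 1 :: bit ^ 'a, axis a 1}"
    by (rule vec.independent_mono[OF independent_cart_basis]) (auto simp: cart_basis_def)
  ultimately have "card {axis b 1 :: bit ^ 'a, axis a 1} \<le> vec.dim (rows ?M)"
    by (metis vec.dim_eq_card_independent vec.dim_subset)
  moreover have "card {axis b 1 :: bit ^ 'a, axis a 1} = 2"
    using assms(1) by (simp add: axis_eq_axis)
  moreover have "({a, b} - looped G) \<union> ({a, b} \<inter> looped G) = {a, b}" by auto
  moreover from this have "rk G ({a, b} - looped G) ({a, b} \<inter> looped G) \<le> card {a, b}"
    using rk_le_card by metis
  ultimately show ?thesis using assms(1) unfolding rk_def row_rank_def_gen by simp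
qed

lemma probe_empty: "subst_poly (probe G {}) (interlace_poly G) = 1"
  by (simp add: subst_poly_probe_interlace_poly rk_empty nullity_def)

lemma probe_vertex:
  assumes "a \<in> verts G"
  shows "subst_poly (probe G {a}) (interlace_poly G) = 1 + var V_var"
  using assms
  by (simp add: subst_poly_probe_interlace_poly Pow_insert nullity_def
      rk_unlooped_vertex Un_Diff_Int rk_empty)

lemma probe_edge:
  assumes "a \<in> verts G" "b \<in> verts G" "a \<noteq> b" "{a, b} \<in> edges G"
  shows "subst_poly (probe G {a, b}) (interlace_poly G) = 1 + 2 * var V_var + var U_var ^ 2"
proof -
  have "Pow {a, b} = {{}, {a}, {b}, {a, b}}" by auto
  moreover have "{a} \<noteq> {b}" "{a, b} \<noteq> {a}" "{a, b} \<noteq> {b}" using assms(3) by auto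
  ultimately show ?thesis
    using assms(1,2)
    by (simp add: subst_poly_probe_interlace_poly nullity_def rk_unlooped_vertex Un_Diff_Int
        rk_empty rk_unlooped_edge[OF assms(3,4)] assms(3) del: insert_Diff_if)
qed

section \<open>Occurrence of vertices in the factors\<close>

lemma prod_single_one:
  "(\<Prod>i\<in>I. Poly_Mapping.single (f i) 1) = Poly_Mapping.single (\<Sum>i\<in>I. f i) (1 :: 'c::comm_semiring_1)"
  by (induction I rule: infinite_finite_induct) (auto simp: mult_single)

lemma var_power: "var z ^ n = Poly_Mapping.single (Poly_Mapping.single z n) 1"
  by (induction n) (auto simp: var_def mult_single simp flip: single_add)

lemma subst_poly_var_id:
  fixes P :: "'a::finite interlace_ring"
  shows "subst_poly var P = P"
proof -
  have "(\<Sum>z\<in>UNIV. Poly_Mapping.single z (Poly_Mapping.lookup m z)) = m" for m :: "'a indet \<Rightarrow>\<^sub>0 nat"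
    by (rule poly_mapping_eqI) (simp add: lookup_sum lookup_single when_def)
  then show ?thesis
    by (simp add: subst_poly_def var_power prod_single_one mult_single sum_of_monomials)
qed

definition vertex_degree :: "'a \<Rightarrow> ('a indet \<Rightarrow>\<^sub>0 nat) \<Rightarrow> nat" where
  "vertex_degree a m = Poly_Mapping.lookup m (X_var a) + Poly_Mapping.lookup m (Y_var a)"

definition occurs :: "'a \<Rightarrow> 'a interlace_ring \<Rightarrow> bool" where
  "occurs a P \<longleftrightarrow> (\<exists>m\<in>Poly_Mapping.keys P. vertex_degree a m \<noteq> 0)"

lemma vertex_degree_add: "vertex_degree a (m + n) = vertex_degree a m + vertex_degree a n"
  by (simp add: vertex_degree_def lookup_add)

text \<open>
  A vertex cannot belong to both \<open>A\<close> and \<open>B\<close>.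
\<close>

lemma vertex_degree_interlace_poly:
  assumes "k \<in> Poly_Mapping.keys (interlace_poly G)"
  shows "vertex_degree a k \<le> 1"
proof -
  obtain A B where AB: "A \<inter> B = {}" "k \<in> Poly_Mapping.keys (interlace_term G A B)"
  proof -
    have "k \<in> (\<Union>p\<in>disjoint_pairs (verts G). Poly_Mapping.keys (case p of (A, B) \<Rightarrow> interlace_term G A B))"
      using assms unfolding interlace_poly_eq by (rule subsetD[OF keys_sum])
    then show ?thesis using that by (auto simp: disjoint_pairs_def)
  qed
  have "interlace_term G A B = Poly_Mapping.single
    ((\<Sum>a\<in>A. Poly_Mapping.single (X_var a) 1) + (\<Sum>b\<in>B. Poly_Mapping.single (Y_var b) 1)
      + Poly_Mapping.single U_var (rk G A B) + Poly_Mapping.single V_var (nullity G A B)) 1"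
    unfolding interlace_term_def var_power by (simp add: var_def prod_single_one mult_single)
  then have "vertex_degree a k = (if a \<in> A then 1 else 0) + (if a \<in> B then 1 else 0)"
    using AB(2) by (simp add: vertex_degree_def lookup_add lookup_sum lookup_single when_def)
  then show ?thesis using AB(1) by auto
qed

lemma subst_poly_probe_cong:
  assumes "\<And>a. occurs a P \<Longrightarrow> a \<in> W \<longleftrightarrow> a \<in> W'"
  shows "subst_poly (probe G W) P = subst_poly (probe G W') P"
proof (rule subst_poly_cong)
  fix m z assume "m \<in> Poly_Mapping.keys P" "Poly_Mapping.lookup m z \<noteq> 0"
  then have "occurs a P" if "z = X_var a \<or> z = Y_var a" for a
    using that unfolding occurs_def vertex_degree_def by auto
  then show "probe G W z = probe G W' z"
    using assms by (cases z) (auto simp: probe_def)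
qed

lemma subst_poly_probe_not_occurs:
  assumes "\<And>a. \<not> occurs a P"
  shows "subst_poly (probe G W) P = P"
proof -
  have "subst_poly (probe G W) P = subst_poly var P"
  proof (rule subst_poly_cong)
    fix m z assume "m \<in> Poly_Mapping.keys P" "Poly_Mapping.lookup m z \<noteq> 0"
    then show "probe G W z = var z"
      using assms unfolding occurs_def vertex_degree_def by (cases z) (auto simp: probe_def)
  qed
  then show ?thesis by (simp add: subst_poly_var_id)
qed

section \<open>Irreducibility\<close>

lemma one_plus_var_not_unit: "\<not> (1 + var V_var :: 'a::finite interlace_ring) dvd 1"
proof
  let ?d = "\<lambda>m :: 'a indet \<Rightarrow>\<^sub>0 nat. Poly_Mapping.lookup m V_var"
  assume "(1 + var V_var :: 'a interlace_ring) dvd 1"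
  moreover have "Poly_Mapping.single V_var 1 \<in> Poly_Mapping.keys (1 + var V_var :: 'a interlace_ring)"
    by (simp add: in_keys_iff lookup_add lookup_one var_def when_def)
  ultimately have "?d (Poly_Mapping.single V_var 1) = 0"
    by (rule unit_degree_zero[rotated]) (simp add: lookup_add)
  then show False by simp
qed

text \<open>
  Substitution preserves units, and a probe at a single vertex gives \<open>1 + v\<close>.
\<close>

lemma interlace_poly_not_unit:
  fixes G :: "'a::finite lgraph"
  assumes "a \<in> verts G"
  shows "\<not> interlace_poly G dvd 1"
proof
  assume "interlace_poly G dvd 1"
  then obtain Q where "1 = interlace_poly G * Q" by blast
  then have "subst_poly (probe G {a}) 1 = subst_poly (probe G {a}) (interlace_poly G * Q)" by simp
  then have "1 = (1 + var V_var :: 'a interlace_ring) * subst_poly (probe G {a}) Q"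
    unfolding subst_poly_one subst_poly_mult probe_vertex[OF assms] .
  then have "(1 + var V_var :: 'a interlace_ring) dvd 1" by (rule dvdI)
  then show False using one_plus_var_not_unit by blast
qed

text \<open>
  The probe at the empty set turns \<open>P * Q\<close> into 1 but does not change \<open>Q\<close>.
\<close>

lemma factor_without_vertices_unit:
  assumes "interlace_poly G = P * Q" "\<And>a. \<not> occurs a Q"
  shows "Q dvd 1"
proof -
  have "1 = subst_poly (probe G {}) (P * Q)"
    using probe_empty[of G] assms(1) by simp
  also have "\<dots> = subst_poly (probe G {}) P * Q"
    by (simp add: subst_poly_mult subst_poly_probe_not_occurs assms(2))
  finally show ?thesis by (metis dvd_triv_right)
qed

text \<open>
  The probe at \<open>{a, b}\<close> sees \<open>P\<close> only through \<open>a\<close> and \<open>Q\<close> only through \<open>b\<close>. The four probes at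
  subsets of \<open>{a, b}\<close> then satisfy the multiplicative relation of a rank one table, while an edge
  would give the table with entries \<open>1\<close>, \<open>1 + v\<close>, \<open>1 + v\<close>, \<open>1 + 2v + u\<^sup>2\<close>.
\<close>

lemma factors_joined_by_no_edge:
  fixes G :: "'a::finite lgraph"
  assumes PQ: "interlace_poly G = P * Q"
    and a: "a \<in> verts G" "\<not> occurs a Q" and b: "b \<in> verts G" "\<not> occurs b P" and "a \<noteq> b"
  shows "{a, b} \<notin> edges G"
proof
  assume edge: "{a, b} \<in> edges G"
  let ?p = "\<lambda>W. subst_poly (probe G W) P" and ?q = "\<lambda>W. subst_poly (probe G W) Q"
  have p: "?p {b} = ?p {}" "?p {a, b} = ?p {a}"
    using b(2) by (intro subst_poly_probe_cong; auto)+
  have q: "?q {a} = ?q {}" "?q {a, b} = ?q {b}"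
    using a(2) by (intro subst_poly_probe_cong; auto)+
  have pq: "?p W * ?q W = subst_poly (probe G W) (interlace_poly G)" for W
    by (simp add: PQ subst_poly_mult)
  have "(?p {a, b} * ?q {a, b}) * (?p {} * ?q {}) = (?p {a} * ?q {a}) * (?p {b} * ?q {b})"
    unfolding p q by (simp only: mult_ac)
  then have "1 + 2 * var V_var + var U_var ^ 2 = (1 + var V_var) * (1 + var V_var :: 'a interlace_ring)"
    unfolding pq probe_empty probe_vertex[OF a(1)] probe_vertex[OF b(1)]
      probe_edge[OF a(1) b(1) assms(6) edge] by simp
  then have "(var U_var ^ 2 :: 'a interlace_ring) = var V_var ^ 2"
    by (simp add: algebra_simps power2_eq_square)
  then have "(Poly_Mapping.single (Poly_Mapping.single U_var 2) 1 :: 'a interlace_ring)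
    = Poly_Mapping.single (Poly_Mapping.single V_var 2) 1"
    unfolding var_power .
  then have "Poly_Mapping.keys (Poly_Mapping.single (Poly_Mapping.single U_var 2) 1 :: 'a interlace_ring)
    = Poly_Mapping.keys (Poly_Mapping.single (Poly_Mapping.single V_var 2) 1 :: 'a interlace_ring)"
    by (rule arg_cong)
  then have "Poly_Mapping.single U_var 2 = (Poly_Mapping.single V_var 2 :: 'a indet \<Rightarrow>\<^sub>0 nat)"
    by simp
  then show False
    by (metis indet.distinct(1) lookup_single_eq lookup_single_not_eq zero_neq_numeral)
qed

lemma irreducible_interlace_poly_connected:
  fixes G :: "'a::finite lgraph"
  assumes "verts G = UNIV" "connected_graph G"
  shows "irreducible (interlace_poly G)"
proof (rule irreducibleI)
  show "interlace_poly G \<noteq> 0"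
    using probe_empty[of G] by (auto simp: subst_poly_def)
  show "\<not> interlace_poly G dvd 1"
    using interlace_poly_not_unit[of undefined G] assms(1) by simp
next
  fix P Q assume PQ: "interlace_poly G = P * Q"
  have excl: "\<not> occurs a P \<or> \<not> occurs a Q" for a
    unfolding occurs_def
    using factor_degree_zero[of "vertex_degree a" P Q, OF vertex_degree_add
        vertex_degree_interlace_poly[of _ G a, unfolded PQ]] by auto
  show "P dvd 1 \<or> Q dvd 1"
  proof (rule ccontr)
    assume "\<not> (P dvd 1 \<or> Q dvd 1)"
    then obtain a b where "occurs a P" "occurs b Q"
      using factor_without_vertices_unit[OF PQ]
        factor_without_vertices_unit[of G Q P] PQ by (metis mult.commute)
    let ?R = "{(c, d). {c, d} \<in> edges G}"
    \<comment> \<open>Follow a path from \<open>a\<close> to \<open>b\<close>: no edge of it leaves the set of vertices that occur in \<open>P\<close>.\<close>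
    have "(a, b) \<in> ?R\<^sup>*" using assms by (auto simp: connected_graph_def)
    then have "occurs b P"
    proof induction
      case base
      show ?case by fact
    next
      case (step c d)
      then have "\<not> occurs c Q" "{c, d} \<in> edges G" using excl by auto
      then show ?case
        using factors_joined_by_no_edge[OF PQ, of c d] step.IH assms(1) by auto
    qed
    with \<open>occurs b Q\<close> excl show False by blast
  qed
qed

text \<open>
  The set of vertices reachable from \<open>a\<close> has no edge to its complement.
\<close>

lemma not_irreducible_interlace_poly_disconnected:
  fixes G :: "'a::finite lgraph"
  assumes "verts G = UNIV" "\<not> connected_graph G"
  shows "\<not> irreducible (interlace_poly G)"
proof -
  let ?R = "{(c, d). {c, d} \<in> edges G}"
  obtain a b where ab: "(a, b) \<notin> ?R\<^sup>*"
    using assms by (auto simp: connected_graph_def)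
  define S where "S = {c. (a, c) \<in> ?R\<^sup>*}"
  have "interlace_poly G = interlace_poly (induced G S) * interlace_poly (induced G (- S))"
  proof (rule interlace_poly_disjoint_union)
    show "{c, d} \<notin> edges G" if "c \<in> S" "d \<in> - S" for c d
      using that unfolding S_def by (auto dest: rtrancl_into_rtrancl)
  qed (use assms(1) in auto)
  moreover have "\<not> interlace_poly (induced G S) dvd 1"
    by (rule interlace_poly_not_unit[of a]) (simp add: induced_def S_def)
  moreover have "\<not> interlace_poly (induced G (- S)) dvd 1"
    by (rule interlace_poly_not_unit[of b]) (use ab in \<open>simp add: induced_def S_def\<close>)
  ultimately show ?thesis by (auto dest: irreducibleD)
qed

theorem theorem1p2:
  fixes G :: "'a::finite lgraph"
  assumes "lgraph G" and "verts G = UNIV"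
  shows "irreducible (interlace_poly G) \<longleftrightarrow> connected_graph G"
  using irreducible_interlace_poly_connected[OF assms(2)]
    not_irreducible_interlace_poly_disconnected[OF assms(2)] by blast

end
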